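(* Let $J:\mathbb{R}^n\to\mathbb{R}$ be a continuous convex function, $A\in\mathbb{R}^{m\times n}$, $b\in\mathbb{R}^m$, $\mu>0$, and let $(x^*,y^* )$ be a pair of optimal primal and dual solutions of $$\min_{x\in\mathbb{R}^n}\;J(x)+\tfrac1{2\mu}\|x\|^2\quad\text{subject to}\quad Ax=b. \qquad(\mathrm P)$$ Let $\mathcal L_\mu(x,y)=J(x)+\frac1{2\mu}\|x\|^2-\langle y,Ax-b\rangle$ and $G_\mu(y)=-\min_{w\in\mathbb{R}^n}\mathcal L_\mu(w,y)$, let $L>0$ be the Lipschitz constant of $\nabla G_\mu$, and let $0<\tau\le\frac1L$. Let $\theta_{-1}:=1$, $\theta_k=\frac{2}{k+2}$ for $k\ge0$, and $$\alpha_{k-1}=1+\theta_k(\theta_{k-1}^{-1}-1).$$ Let $\{x^k\}$ be generated by the accelerated linearized Bregman method: $x^0=\tilde x^0=\tilde p^0=p^0=0$ and for $k=0,1,\dots$ $$x^{k+1}=\arg\min_{x}\; D_J^{\tilde p^k}(x,\tilde x^k)+\tau\langle A^\top(A\tilde x^k-b),x\rangle+\tfrac1{2\mu}\|x-\tilde x^k\|^2,$$ $$p^{k+1}=\tilde p^k-\tau A^\top(A\tilde x^k-b)-\tfrac1\mu(x^{k+1}-\tilde x^k),$$ $$\tilde x^{k+1}=\alpha_kx^{k+1}+(1-\alpha_k)x^k,\qquad \tilde p^{k+1}=\alpha_kp^{k+1}+(1-\alpha_k)p^k.$$ Let $\{y^k\}$ be defined by $\tilde y^0=y^0=\tau b$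 and for $k=0,1,\dots$ $$w^{k+1}=\arg\min_{w}\;\mathcal L_\mu(w,\tilde y^k),\qquad y^{k+1}=\tilde y^k-\tau(Aw^{k+1}-b),\qquad \tilde y^{k+1}=\alpha_ky^{k+1}+(1-\alpha_k)y^k.$$ Then for all $k\ge1$, $$G_\mu(y^k)-G_\mu(y^* )\le\frac{2\|y^*-y^0\|^2}{\tau k^2}.$$ Thus, if furthermore $\tau\ge\beta/L$ with $0<\beta\le1$, then for every $\epsilon>0$ the pair $(x^{k+1},y^k)$ is an $\epsilon$-optimal solution of (P) with respect to the Lagrangian function, i.e. $\mathcal L_\mu(x^*,y^* )-\mathcal L_\mu(x^{k+1},y^k)\le\epsilon$, whenever $k\ge\lceil\sqrt{C/\epsilon}\,\rceil$, where $C:=\frac{2L\|y^*-y^0\|^2}{\beta}$.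
   Context: $\|\cdot\|$ is the Euclidean norm and $\langle\cdot,\cdot\rangle$ the standard inner product. For vectors $u,v,p\in\mathbb{R}^n$, $D_J^p(u,v):=J(u)-J(v)-\langle p,u-v\rangle$. A pair of optimal primal and dual solutions means: $x^*$ solves (P), and $y^*$ is a minimizer of $G_\mu$ over $\mathbb{R}^m$ (the Lagrangian dual of (P), written as a minimization problem), with $\mathcal L_\mu(x^*,y^* )=-G_\mu(y^* )$. The function $G_\mu$ is differentiable with $\nabla G_\mu(y)=Aw_y-b$, where $w_y=\arg\min_w\mathcal L_\mu(w,y)$; $L$ being the Lipschitz constant of $\nabla G_\mu$ means $\|\nabla G_\mu(y)-\nabla G_\mu(y')\|\le L\|y-y'\|$ for all $y,y'\in\mathbb{R}^m$. All minimizers in the algorithms are unique by strong convexity. *)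

theory Defs
  imports "HOL-Analysis.Analysis"
begin

definition gradient :: "('a::real_inner \<Rightarrow> real) \<Rightarrow> 'a \<Rightarrow> 'a" where
  "gradient f y = (THE D. GDERIV f y :> D)"

definition bregman_dist ::
  "('a::real_inner \<Rightarrow> real) \<Rightarrow> 'a \<Rightarrow> 'a \<Rightarrow> 'a \<Rightarrow> real" where
  "bregman_dist J p u v = J u - J v - p \<bullet> (u - v)"

definition primal_obj :: "(real ^ 'n \<Rightarrow> real) \<Rightarrow> real \<Rightarrow> real ^ 'n \<Rightarrow> real" where
  "primal_obj J \<mu> x = J x + 1 / (2 * \<mu>) * (norm x)\<^sup>2"

definition lagrangian ::
  "(real ^ 'n \<Rightarrow> real) \<Rightarrow> real ^ 'n ^ 'm \<Rightarrow> real ^ 'm \<Rightarrow> real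
     \<Rightarrow> real ^ 'n \<Rightarrow> real ^ 'm \<Rightarrow> real" where
  "lagrangian J A b \<mu> x y = J x + 1 / (2 * \<mu>) * (norm x)\<^sup>2 - y \<bullet> (A *v x - b)"

text \<open>The minimum over \<open>w\<close> is the value at a minimizer, which exists (and is unique) when
  \<open>J\<close> is convex and \<open>\<mu> > 0\<close>, since the Lagrangian is then strongly convex in \<open>w\<close>.\<close>

definition dual_fun ::
  "(real ^ 'n \<Rightarrow> real) \<Rightarrow> real ^ 'n ^ 'm \<Rightarrow> real ^ 'm \<Rightarrow> real
     \<Rightarrow> real ^ 'm \<Rightarrow> real" where
  "dual_fun J A b \<mu> y =
     - lagrangian J A b \<mu> (ARG_MIN (\<lambda>w. lagrangian J A b \<mu> w y) w. True) y"

definition optimal_pair ::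
  "(real ^ 'n \<Rightarrow> real) \<Rightarrow> real ^ 'n ^ 'm \<Rightarrow> real ^ 'm \<Rightarrow> real
     \<Rightarrow> real ^ 'n \<Rightarrow> real ^ 'm \<Rightarrow> bool" where
  "optimal_pair J A b \<mu> xs ys \<longleftrightarrow>
     is_arg_min (primal_obj J \<mu>) (\<lambda>x. A *v x = b) xs \<and>
     is_arg_min (dual_fun J A b \<mu>) (\<lambda>_. True) ys \<and>
     lagrangian J A b \<mu> xs ys = - dual_fun J A b \<mu> ys"

text \<open>Integer indices accommodate \<open>\<theta>\<close> at \<open>-1\<close>; values below that are never used.\<close>

definition \<theta> :: "int \<Rightarrow> real" where
  "\<theta> k = (if k = -1 then 1 else 2 / (of_int k + 2))"

text \<open>The usual display \<open>\<alpha> (k - 1) = 1 + \<theta> k * (inverse (\<theta> (k - 1)) - 1)\<close>, with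
  the index shifted by one.\<close>

definition \<alpha> :: "int \<Rightarrow> real" where
  "\<alpha> k = 1 + \<theta> (k + 1) * (inverse (\<theta> k) - 1)"

text \<open>In the next two definitions \<open>xt\<close>, \<open>pt\<close>, \<open>yt\<close> are the extrapolated
  (tilde) sequences. The value of \<open>w\<close> at \<open>0\<close> is unconstrained.\<close>

definition accelerated_linearized_bregman ::
  "(real ^ 'n \<Rightarrow> real) \<Rightarrow> real ^ 'n ^ 'm \<Rightarrow> real ^ 'm \<Rightarrow> real \<Rightarrow> real
     \<Rightarrow> (nat \<Rightarrow> real ^ 'n) \<Rightarrow> (nat \<Rightarrow> real ^ 'n)
     \<Rightarrow> (nat \<Rightarrow> real ^ 'n) \<Rightarrow> (nat \<Rightarrow> real ^ 'n) \<Rightarrow> bool" where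
  "accelerated_linearized_bregman J A b \<mu> \<tau> x p xt pt \<longleftrightarrow>
     x 0 = 0 \<and> xt 0 = 0 \<and> pt 0 = 0 \<and> p 0 = 0 \<and>
     (\<forall>k.
        is_arg_min
          (\<lambda>z. bregman_dist J (pt k) z (xt k)
                + \<tau> * ((transpose A *v (A *v xt k - b)) \<bullet> z)
                + 1 / (2 * \<mu>) * (norm (z - xt k))\<^sup>2)
          (\<lambda>_. True) (x (Suc k)) \<and>
        p (Suc k) = pt k - \<tau> *\<^sub>R (transpose A *v (A *v xt k - b))
                      - (1 / \<mu>) *\<^sub>R (x (Suc k) - xt k) \<and>
        xt (Suc k) = \<alpha> (int k) *\<^sub>R x (Suc k) + (1 - \<alpha> (int k)) *\<^sub>R x k \<and>
        pt (Suc k) = \<alpha> (int k) *\<^sub>R p (Suc k) + (1 - \<alpha> (int k)) *\<^sub>R p k)"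

definition accelerated_dual_sequence ::
  "(real ^ 'n \<Rightarrow> real) \<Rightarrow> real ^ 'n ^ 'm \<Rightarrow> real ^ 'm \<Rightarrow> real \<Rightarrow> real
     \<Rightarrow> (nat \<Rightarrow> real ^ 'n) \<Rightarrow> (nat \<Rightarrow> real ^ 'm) \<Rightarrow> (nat \<Rightarrow> real ^ 'm) \<Rightarrow> bool" where
  "accelerated_dual_sequence J A b \<mu> \<tau> w y yt \<longleftrightarrow>
     yt 0 = \<tau> *\<^sub>R b \<and> y 0 = \<tau> *\<^sub>R b \<and>
     (\<forall>k.
        is_arg_min (\<lambda>z. lagrangian J A b \<mu> z (yt k)) (\<lambda>_. True) (w (Suc k)) \<and>
        y (Suc k) = yt k - \<tau> *\<^sub>R (A *v w (Suc k) - b) \<and>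
        yt (Suc k) = \<alpha> (int k) *\<^sub>R y (Suc k) + (1 - \<alpha> (int k)) *\<^sub>R y k)"

end

theory Submission
  imports Defs
begin

text \<open>
  The dual iteration is Nesterov's accelerated gradient method applied to the convex function
  \<open>dual_fun\<close>, whose gradient at a point is the constraint residual \<open>A *v w - b\<close> of the
  Lagrangian minimizer \<open>w\<close>. The proof makes this reading precise and then runs the standard
  potential argument.

  A convex finite function decreases at most linearly in the norm, so adding a positive multiple
  of \<open>(norm w)\<^sup>2\<close> makes every function \<open>\<lambda>w. lagrangian J A b \<mu> w y\<close> attain its minimum, with
  quadratic growth around the minimizer (\<open>convex_plus_square_has_min\<close>,
  \<open>convex_plus_square_growth\<close>). Testing the minimality at \<open>u\<close> with the minimizer at \<open>v\<close> shows that
  \<open>A *v w - b\<close> is a subgradient of the dual function at \<open>v\<close>; the quadratic growth bounds the error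
  of the linearization from above by a multiple of \<open>(norm (u - v))\<^sup>2\<close>. So the residual is the gradient
  (\<open>gradient_dual_fun\<close>), and the Lipschitz hypothesis, which speaks about \<open>gradient\<close>, yields the
  descent inequality with the given constant \<open>L\<close> (\<open>lipschitz_gradient_descent\<close>).

  The rate (\<open>nesterov_rate\<close>) comes from a potential that is a weighted sum of the objective gap and
  of the squared distance of an auxiliary point to the minimizer; the weights are chosen such that
  one step never increases it. The weight of the gap grows quadratically in \<open>k\<close>, while the
  potential starts at half the squared distance from the starting point to the minimizer.

  The second claim follows by weak duality: at every primal point \<open>z\<close>, the Lagrangian at
  \<open>(z, y k)\<close> is at least \<open>- dual_fun J A b \<mu> (y k)\<close>, so the gap of the Lagrangian values is at most
  the gap of the dual values. For \<open>k = 0\<close> the condition on \<open>k\<close> forces \<open>y 0 = ys\<close>.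
\<close>

section \<open>Minimizing a convex function plus a multiple of the squared norm\<close>

text \<open>A convex function that is bounded by \<open>K\<close> on the unit ball satisfies
  \<open>h x \<ge> - 2 * K * norm x\<close> outside of it, by convexity along the ray from the origin. The square
  therefore wins far away, and the minimum over a large ball is global.\<close>

lemma convex_plus_square_has_min:
  fixes h :: "'a::euclidean_space \<Rightarrow> real"
  assumes conv: "convex_on UNIV h" and cont: "continuous_on UNIV h" and c: "c > 0"
  shows "\<exists>x. \<forall>z. h x + c * (norm x)\<^sup>2 \<le> h z + c * (norm z)\<^sup>2"
proof -
  let ?f = "\<lambda>x. h x + c * (norm x)\<^sup>2"
  have "bounded (h ` cball 0 1)"
    by (intro compact_imp_bounded compact_continuous_image compact_cball
        continuous_on_subset[OF cont]) auto
  then obtain K where K: "\<And>x. x \<in> cball 0 1 \<Longrightarrow> \<bar>h x\<bar> \<le> K"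
    unfolding bounded_iff by (metis imageI real_norm_def)
  have K0: "\<bar>h 0\<bar> \<le> K" using K[of 0] by simp
  \<comment> \<open>Beyond \<open>R\<close> one factor \<open>c * norm z\<close> is at least \<open>3 * K\<close>: it absorbs the linear decrease
    \<open>2 * K\<close> of \<open>h\<close> and the value \<open>h 0 \<le> K\<close> at the competitor \<open>0\<close>.\<close>
  define R where "R = 1 + 3 * K / c"
  have R: "R \<ge> 1" using K0 c by (simp add: R_def)
  have far: "?f 0 \<le> ?f z" if z: "norm z \<ge> R" for z
  proof -
    let ?r = "norm z"
    have r: "?r \<ge> 1" using z R by linarith
    have "h ((1 - 1 / ?r) *\<^sub>R 0 + (1 / ?r) *\<^sub>R z) \<le> (1 - 1 / ?r) * h 0 + 1 / ?r * h z"
      by (rule convex_onD[OF conv]) (use r in \<open>auto simp: divide_le_eq\<close>)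
    then have "?r * h ((1 / ?r) *\<^sub>R z) \<le> ?r * ((1 - 1 / ?r) * h 0 + 1 / ?r * h z)"
      using r by (intro mult_left_mono) auto
    also have "\<dots> = (?r - 1) * h 0 + h z"
      using r by (simp add: field_simps)
    finally have 1: "?r * h ((1 / ?r) *\<^sub>R z) \<le> (?r - 1) * h 0 + h z" .
    have "\<bar>h ((1 / ?r) *\<^sub>R z)\<bar> \<le> K" using r by (intro K) auto
    then have 2: "?r * (- K) \<le> ?r * h ((1 / ?r) *\<^sub>R z)"
      using r by (intro mult_left_mono) auto
    have 3: "(?r - 1) * h 0 \<le> (?r - 1) * K" using r K0 by (intro mult_left_mono) auto
    have "3 * K \<le> c * ?r" using z c by (simp add: R_def field_simps)
    then have "?r * (3 * K) \<le> ?r * (c * ?r)" using r by (intro mult_left_mono) auto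
    moreover have "K \<le> ?r * K" using r K0 by (simp add: mult_le_cancel_right1)
    ultimately show ?thesis
      using 1 2 3 K0 by (simp add: power2_eq_square algebra_simps)
  qed
  have "continuous_on (cball 0 R) ?f"
    by (intro continuous_intros continuous_on_subset[OF cont]) auto
  moreover have "cball 0 R \<noteq> ({} :: 'a set)" using R by simp
  ultimately obtain x where x: "\<And>z. z \<in> cball 0 R \<Longrightarrow> ?f x \<le> ?f z"
    using continuous_attains_inf[OF compact_cball, of 0 R ?f] by blast
  have "?f x \<le> ?f z" for z
    using x[of z] x[of 0] far[of z] R by (cases "norm z \<le> R") auto
  then show ?thesis by blast
qed

text \<open>Comparing the minimizer with a point at fraction \<open>t\<close> of the segment to \<open>z\<close> gives the bound
  with the factor \<open>1 - t\<close>; then \<open>t\<close> tends to \<open>0\<close>.\<close>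

lemma convex_plus_square_growth:
  fixes h :: "'a::real_inner \<Rightarrow> real"
  assumes conv: "convex_on UNIV h"
    and min: "\<And>z. h x + c * (norm x)\<^sup>2 \<le> h z + c * (norm z)\<^sup>2"
  shows "h x + c * (norm x)\<^sup>2 + c * (norm (z - x))\<^sup>2 \<le> h z + c * (norm z)\<^sup>2"
proof -
  let ?f = "\<lambda>x. h x + c * (norm x)\<^sup>2"
  have *: "?f x + c * (1 - t) * (norm (z - x))\<^sup>2 \<le> ?f z" if t: "0 < t" "t < 1" for t
  proof -
    let ?v = "(1 - t) *\<^sub>R x + t *\<^sub>R z"
    have "(norm ?v)\<^sup>2 = (1 - t) * (norm x)\<^sup>2 + t * (norm z)\<^sup>2 - t * (1 - t) * (norm (z - x))\<^sup>2"
      unfolding power2_norm_eq_inner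
      by (simp add: inner_add inner_diff inner_commute algebra_simps)
    moreover have "h ?v \<le> (1 - t) * h x + t * h z"
      by (rule convex_onD[OF conv]) (use t in auto)
    ultimately have "?f x \<le> (1 - t) * h x + t * h z
        + c * ((1 - t) * (norm x)\<^sup>2 + t * (norm z)\<^sup>2 - t * (1 - t) * (norm (z - x))\<^sup>2)"
      using min[of ?v] by simp
    then have "t * (?f x + c * (1 - t) * (norm (z - x))\<^sup>2) \<le> t * ?f z"
      by (simp add: algebra_simps)
    then show ?thesis using t by simp
  qed
  have "((\<lambda>t. ?f x + c * (1 - t) * (norm (z - x))\<^sup>2)
      \<longlongrightarrow> ?f x + c * (1 - 0) * (norm (z - x))\<^sup>2) (at_right 0)"
    by (intro tendsto_intros)
  moreover have "\<forall>\<^sub>F t in at_right 0. ?f x + c * (1 - t) * (norm (z - x))\<^sup>2 \<le> ?f z"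
    unfolding eventually_at_right_field using * by (intro exI[of _ 1]) auto
  ultimately have "?f x + c * (1 - 0) * (norm (z - x))\<^sup>2 \<le> ?f z"
    by (rule tendsto_upperbound) auto
  then show ?thesis by simp
qed

section \<open>Gradients\<close>

lemma gradient_eqI: "GDERIV f v :> g \<Longrightarrow> gradient f v = g"
  unfolding gradient_def
proof (rule the_equality)
  fix D assume "GDERIV f v :> g" "GDERIV f v :> D"
  then have "(\<lambda>h. h \<bullet> g) = (\<lambda>h. h \<bullet> D)"
    unfolding gderiv_def by (rule has_derivative_unique)
  then show "D = g"
    by (metis vector_eq_rdot inner_commute)
qed

lemma gderiv_if_quadratic_remainder:
  fixes f :: "'a::real_inner \<Rightarrow> real"
  assumes "\<And>u. \<bar>f u - f v - g \<bullet> (u - v)\<bar> \<le> M * (norm (u - v))\<^sup>2"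
  shows "GDERIV f v :> g"
  unfolding gderiv_def
proof (rule has_derivativeI_sandwich[where e = 1 and H = "\<lambda>u. M * norm (u - v)"])
  show "bounded_linear (\<lambda>h. h \<bullet> g)" by (rule bounded_linear_inner_left)
  show "((\<lambda>u. M * norm (u - v)) \<longlongrightarrow> 0) (at v)"
    by (auto intro!: tendsto_eq_intros)
  fix u assume "u \<noteq> v"
  then show "norm (f u - f v - (u - v) \<bullet> g) / norm (u - v) \<le> M * norm (u - v)"
    using assms[of u] by (simp add: divide_le_eq power2_eq_square inner_commute mult.assoc)
qed simp

text \<open>Along the segment from \<open>v\<close> to \<open>u\<close>, the error of the linearization minus the quadratic bound
  has a derivative that the Lipschitz condition and Cauchy-Schwarz make nonpositive.\<close>

lemma lipschitz_gradient_descent: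
  fixes f :: "'a::real_inner \<Rightarrow> real"
  assumes g: "\<And>v. GDERIV f v :> g v" and lip: "L-lipschitz_on UNIV g"
  shows "f u \<le> f v + g v \<bullet> (u - v) + L / 2 * (norm (u - v))\<^sup>2"
proof -
  let ?d = "u - v"
  let ?q = "\<lambda>t. f (v + t *\<^sub>R ?d) - t * (g v \<bullet> ?d) - L / 2 * t\<^sup>2 * (norm ?d)\<^sup>2"
  have "?q 1 \<le> ?q 0"
  proof (rule DERIV_nonpos_imp_nonincreasing[where f = ?q])
    fix t :: real assume t: "0 \<le> t" "t \<le> 1"
    let ?D = "g (v + t *\<^sub>R ?d) \<bullet> ?d - g v \<bullet> ?d - L * t * (norm ?d)\<^sup>2"
    have "((\<lambda>t. f (v + t *\<^sub>R ?d)) has_derivative (\<lambda>s. (s *\<^sub>R ?d) \<bullet> g (v + t *\<^sub>R ?d))) (at t)"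
      by (rule has_derivative_compose[where f = "\<lambda>t. v + t *\<^sub>R ?d" and g = f,
            OF _ g[unfolded gderiv_def]]) (auto intro!: derivative_eq_intros)
    then have "DERIV (\<lambda>t. f (v + t *\<^sub>R ?d)) t :> g (v + t *\<^sub>R ?d) \<bullet> ?d"
      by (rule has_derivative_imp_has_field_derivative) (simp add: inner_commute)
    then have "DERIV ?q t :> ?D"
      by (auto intro!: derivative_eq_intros)
    moreover have "?D \<le> 0"
    proof -
      have "g (v + t *\<^sub>R ?d) \<bullet> ?d - g v \<bullet> ?d = (g (v + t *\<^sub>R ?d) - g v) \<bullet> ?d"
        by (simp add: inner_diff_left)
      also have "\<dots> \<le> norm (g (v + t *\<^sub>R ?d) - g v) * norm ?d"
        by (rule norm_cauchy_schwarz)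
      also have "\<dots> \<le> (L * (t * norm ?d)) * norm ?d"
        using lipschitz_onD[OF lip, of "v + t *\<^sub>R ?d" v] t
        by (intro mult_right_mono) (auto simp: dist_norm)
      finally show ?thesis by (simp add: power2_eq_square mult.assoc)
    qed
    ultimately show "\<exists>D. DERIV ?q t :> D \<and> D \<le> 0" by blast
  qed simp
  then show ?thesis by simp
qed

section \<open>The rate of the accelerated gradient method\<close>

text \<open>With \<open>s = (k + 2) / 2\<close> and \<open>z k = y k + s * (yt k - y k)\<close>, the potential is
  \<open>\<tau> * k * (k + 2) / 4 * (f (y k) - f u) + (norm (z k - u))\<^sup>2 / 2\<close>. The momentum factor
  \<open>k / (k + 3)\<close> is the one for which \<open>z\<close> moves by \<open>- s * \<tau>\<close> times the gradient at \<open>yt k\<close>. The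
  weight satisfies \<open>k * (k + 2) / 4 = s\<^sup>2 - s\<close>, and one step produces the weight
  \<open>s\<^sup>2\<close>, which exceeds the next weight \<open>(k + 1) * (k + 3) / 4\<close>; the minimality of \<open>u\<close> allows the
  replacement.\<close>

lemma nesterov_rate:
  fixes f :: "'a::real_inner \<Rightarrow> real"
  assumes min: "\<And>v. f u \<le> f v"
    and lower: "\<And>v v'. f v + g v \<bullet> (v' - v) \<le> f v'"
    and upper: "\<And>v v'. f v' \<le> f v + g v \<bullet> (v' - v) + L / 2 * (norm (v' - v))\<^sup>2"
    and \<tau>: "0 < \<tau>" "L * \<tau> \<le> 1"
    and init: "yt 0 = y 0"
    and step: "\<And>k. y (Suc k) = yt k - \<tau> *\<^sub>R g (yt k)"
    and momentum: "\<And>k. yt (Suc k) = y (Suc k) + (real k / (real k + 3)) *\<^sub>R (y (Suc k) - y k)"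
  shows "f (y (Suc k)) - f u \<le> 2 * (norm (u - y 0))\<^sup>2 / (\<tau> * (real k + 2)\<^sup>2)"
proof -
  define s where "s k = (real k + 2) / 2" for k
  define z where "z k = y k + s k *\<^sub>R (yt k - y k)" for k
  have z_Suc: "z (Suc k) = z k - (s k * \<tau>) *\<^sub>R g (yt k)" for k
  proof -
    have "s (Suc k) * (real k / (real k + 3)) = s k - 1"
      by (simp add: s_def field_simps)
    then have "z (Suc k) = y (Suc k) + (s k - 1) *\<^sub>R (y (Suc k) - y k)"
      unfolding z_def momentum by simp
    also have "\<dots> = z k - (s k * \<tau>) *\<^sub>R g (yt k)"
      unfolding z_def step by (simp add: algebra_simps)
    finally show ?thesis .
  qed
  have one_step: "\<tau> * (s k)\<^sup>2 * (f (y (Suc k)) - f u) + (norm (z (Suc k) - u))\<^sup>2 / 2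
      \<le> \<tau> * ((s k)\<^sup>2 - s k) * (f (y k) - f u) + (norm (z k - u))\<^sup>2 / 2" for k
  proof -
    let ?g = "g (yt k)" and ?s = "s k"
    have s: "?s \<ge> 1" by (simp add: s_def)
    have "f (y (Suc k)) \<le> f (yt k) - \<tau> * (norm ?g)\<^sup>2 + L / 2 * (\<tau>\<^sup>2 * (norm ?g)\<^sup>2)"
      using upper[of "y (Suc k)" "yt k"] \<tau>
      by (simp add: step power_mult_distrib power2_norm_eq_inner)
    also have "L / 2 * (\<tau>\<^sup>2 * (norm ?g)\<^sup>2) \<le> \<tau> / 2 * (norm ?g)\<^sup>2"
      using mult_right_mono[OF \<tau>(2), of "\<tau> / 2 * (norm ?g)\<^sup>2"] \<tau>(1)
      by (simp add: power2_eq_square mult_ac)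
    finally have dec: "f (y (Suc k)) \<le> f (yt k) - \<tau> / 2 * (norm ?g)\<^sup>2" by simp
    have "?s * f (y (Suc k)) \<le> ?s * (f (yt k) - \<tau> / 2 * (norm ?g)\<^sup>2)"
      using s by (intro mult_left_mono[OF dec]) auto
    moreover have "(?s - 1) * (f (yt k) + ?g \<bullet> (y k - yt k)) \<le> (?s - 1) * f (y k)"
      using s by (intro mult_left_mono[OF lower]) auto
    moreover have "?g \<bullet> (u - yt k) + (?s - 1) * (?g \<bullet> (y k - yt k)) = - (?g \<bullet> (z k - u))"
      by (simp add: z_def inner_diff_right inner_add_right algebra_simps)
    ultimately have "?s * (f (y (Suc k)) - f u)
        \<le> (?s - 1) * (f (y k) - f u) + ?g \<bullet> (z k - u) - ?s * \<tau> / 2 * (norm ?g)\<^sup>2"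
      using lower[of "yt k" u] by (simp add: algebra_simps)
    from mult_left_mono[OF this, of "\<tau> * ?s"]
    have "\<tau> * ?s\<^sup>2 * (f (y (Suc k)) - f u) \<le> \<tau> * (?s\<^sup>2 - ?s) * (f (y k) - f u)
        + (\<tau> * ?s) * (?g \<bullet> (z k - u)) - (\<tau> * ?s)\<^sup>2 / 2 * (norm ?g)\<^sup>2"
      using \<tau>(1) s by (simp add: power2_eq_square algebra_simps)
    moreover have "(norm (z (Suc k) - u))\<^sup>2
        = (norm (z k - u))\<^sup>2 - 2 * (\<tau> * ?s) * (?g \<bullet> (z k - u)) + (\<tau> * ?s)\<^sup>2 * (norm ?g)\<^sup>2"
      unfolding z_Suc power2_norm_eq_inner
      by (simp add: inner_diff inner_commute power2_eq_square algebra_simps)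
    ultimately show ?thesis by (simp add: field_simps)
  qed
  have potential: "\<tau> * ((s k)\<^sup>2 - s k) * (f (y k) - f u) + (norm (z k - u))\<^sup>2 / 2
      \<le> (norm (u - y 0))\<^sup>2 / 2" for k
  proof (induction k)
    case 0
    then show ?case by (simp add: s_def z_def init norm_minus_commute power2_eq_square)
  next
    case (Suc k)
    have "(s (Suc k))\<^sup>2 - s (Suc k) \<le> (s k)\<^sup>2"
      by (simp add: s_def power2_eq_square field_simps)
    then have "\<tau> * ((s (Suc k))\<^sup>2 - s (Suc k)) * (f (y (Suc k)) - f u)
        \<le> \<tau> * (s k)\<^sup>2 * (f (y (Suc k)) - f u)"
      using \<tau>(1) min by (intro mult_right_mono mult_left_mono) auto
    then show ?case using one_step[of k] Suc by linarith
  qed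
  have "\<tau> * (s k)\<^sup>2 * (f (y (Suc k)) - f u) \<le> (norm (u - y 0))\<^sup>2 / 2"
    using one_step[of k] potential[of k] zero_le_power2[of "norm (z (Suc k) - u)"] by linarith
  then have "(f (y (Suc k)) - f u) * (\<tau> * (real k + 2)\<^sup>2) \<le> 2 * (norm (u - y 0))\<^sup>2"
    by (simp add: s_def power_divide mult_ac)
  then show ?thesis
    using \<tau>(1) by (simp add: pos_le_divide_eq)
qed

section \<open>The dual function\<close>

lemma lagrangian_eq_convex_plus_square:
  "lagrangian J A b \<mu> x y = (J x - y \<bullet> (A *v x - b)) + 1 / (2 * \<mu>) * (norm x)\<^sup>2"
  by (simp add: lagrangian_def)

lemma convex_on_lagrangian_part:
  fixes A :: "real ^ 'n ^ 'm"
  assumes "convex_on UNIV J"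
  shows "convex_on UNIV (\<lambda>x. J x - y \<bullet> (A *v x - b))"
proof (rule convex_onI)
  fix t :: real and u v :: "real ^ 'n" assume t: "0 < t" "t < 1"
  have "J ((1 - t) *\<^sub>R u + t *\<^sub>R v) \<le> (1 - t) * J u + t * J v"
    by (rule convex_onD[OF assms]) (use t in auto)
  then show "J ((1 - t) *\<^sub>R u + t *\<^sub>R v) - y \<bullet> (A *v ((1 - t) *\<^sub>R u + t *\<^sub>R v) - b)
      \<le> (1 - t) * (J u - y \<bullet> (A *v u - b)) + t * (J v - y \<bullet> (A *v v - b))"
    by (simp add: matrix_vector_right_distrib matrix_vector_mult_scaleR inner_add_right
        inner_diff_right algebra_simps)
qed simp

lemma lagrangian_has_arg_min:
  fixes A :: "real ^ 'n ^ 'm"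
  assumes "continuous_on UNIV J" "convex_on UNIV J" "\<mu> > 0"
  shows "\<exists>w. is_arg_min (\<lambda>z. lagrangian J A b \<mu> z y) (\<lambda>_. True) w"
proof -
  have "continuous_on UNIV (\<lambda>x. J x - y \<bullet> (A *v x - b))"
    using assms(1) by (intro continuous_intros matrix_vector_mult_linear_continuous_on)
  from convex_plus_square_has_min[OF convex_on_lagrangian_part[OF assms(2)] this, of "1 / (2 * \<mu>)"]
  show ?thesis
    using assms(3) unfolding is_arg_min_linorder lagrangian_eq_convex_plus_square by simp
qed

lemma dual_fun_arg_min:
  assumes "is_arg_min (\<lambda>z. lagrangian J A b \<mu> z y) (\<lambda>_. True) w"
  shows "dual_fun J A b \<mu> y = - lagrangian J A b \<mu> w y"
proof -
  have "is_arg_min (\<lambda>z. lagrangian J A b \<mu> z y) (\<lambda>_. True)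
      (ARG_MIN (\<lambda>z. lagrangian J A b \<mu> z y) z. True)"
    unfolding arg_min_def using assms by (rule someI)
  then show ?thesis
    using assms unfolding dual_fun_def is_arg_min_linorder by (auto intro: antisym)
qed

lemma weak_duality:
  fixes A :: "real ^ 'n ^ 'm"
  assumes "continuous_on UNIV J" "convex_on UNIV J" "\<mu> > 0"
  shows "- dual_fun J A b \<mu> y \<le> lagrangian J A b \<mu> x y"
proof -
  obtain w where "is_arg_min (\<lambda>z. lagrangian J A b \<mu> z y) (\<lambda>_. True) w"
    using lagrangian_has_arg_min[OF assms] by blast
  then show ?thesis
    by (simp add: dual_fun_arg_min is_arg_min_linorder)
qed

text \<open>The dual function is a supremum of functions that are affine in the multiplier; the one
  that is active at \<open>v\<close> has the residual as its slope.\<close>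

lemma dual_fun_subgradient:
  fixes A :: "real ^ 'n ^ 'm"
  assumes "continuous_on UNIV J" "convex_on UNIV J" "\<mu> > 0"
    and w: "is_arg_min (\<lambda>z. lagrangian J A b \<mu> z v) (\<lambda>_. True) w"
  shows "dual_fun J A b \<mu> v + (A *v w - b) \<bullet> (u - v) \<le> dual_fun J A b \<mu> u"
  using weak_duality[OF assms(1-3), of A b u w] dual_fun_arg_min[OF w]
  by (simp add: lagrangian_def inner_commute inner_diff_right)

text \<open>With \<open>d\<close> the difference of the minimizers at \<open>u\<close> and \<open>v\<close>, quadratic growth at \<open>v\<close> bounds the
  error of the linearization by \<open>(u - v) \<bullet> (A *v d) - (norm d)\<^sup>2 / (2 * \<mu>)\<close>. Its maximum over all
  \<open>d\<close> is at most \<open>\<mu> / 2 * K\<^sup>2 * (norm (u - v))\<^sup>2\<close>, where \<open>K\<close> bounds the operator norm of \<open>A\<close>.\<close>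

lemma dual_fun_upper:
  fixes A :: "real ^ 'n ^ 'm"
  assumes J: "continuous_on UNIV J" "convex_on UNIV J" and \<mu>: "\<mu> > 0"
    and w: "is_arg_min (\<lambda>z. lagrangian J A b \<mu> z v) (\<lambda>_. True) w"
    and K: "\<And>x. norm (A *v x) \<le> K * norm x"
  shows "dual_fun J A b \<mu> u
    \<le> dual_fun J A b \<mu> v + (A *v w - b) \<bullet> (u - v) + \<mu> / 2 * K\<^sup>2 * (norm (u - v))\<^sup>2"
proof -
  obtain w' where w': "is_arg_min (\<lambda>z. lagrangian J A b \<mu> z u) (\<lambda>_. True) w'"
    using lagrangian_has_arg_min[OF J \<mu>] by blast
  let ?d = "w' - w"
  have "lagrangian J A b \<mu> w v + 1 / (2 * \<mu>) * (norm ?d)\<^sup>2 \<le> lagrangian J A b \<mu> w' v"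
    using w unfolding is_arg_min_linorder lagrangian_eq_convex_plus_square
    by (intro convex_plus_square_growth convex_on_lagrangian_part J) auto
  then have "dual_fun J A b \<mu> u - dual_fun J A b \<mu> v - (A *v w - b) \<bullet> (u - v)
      \<le> (u - v) \<bullet> (A *v ?d) - 1 / (2 * \<mu>) * (norm ?d)\<^sup>2"
    unfolding dual_fun_arg_min[OF w] dual_fun_arg_min[OF w'] lagrangian_def
    by (simp add: matrix_vector_mult_diff_distrib inner_diff_left inner_diff_right inner_commute)
  also have "(u - v) \<bullet> (A *v ?d) \<le> norm (u - v) * (K * norm ?d)"
    by (rule order_trans[OF norm_cauchy_schwarz]) (intro mult_left_mono K norm_ge_zero)
  also have "norm (u - v) * (K * norm ?d) - 1 / (2 * \<mu>) * (norm ?d)\<^sup>2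
      = \<mu> / 2 * K\<^sup>2 * (norm (u - v))\<^sup>2 - (\<mu> * K * norm (u - v) - norm ?d)\<^sup>2 / (2 * \<mu>)"
    using \<mu> by (simp add: power2_eq_square field_simps)
  also have "\<dots> \<le> \<mu> / 2 * K\<^sup>2 * (norm (u - v))\<^sup>2"
    using \<mu> by simp
  finally show ?thesis by simp
qed

lemma gderiv_dual_fun:
  fixes A :: "real ^ 'n ^ 'm"
  assumes J: "continuous_on UNIV J" "convex_on UNIV J" and \<mu>: "\<mu> > 0"
    and w: "is_arg_min (\<lambda>z. lagrangian J A b \<mu> z v) (\<lambda>_. True) w"
  shows "GDERIV (dual_fun J A b \<mu>) v :> A *v w - b"
proof -
  obtain K where K: "\<And>x. norm (A *v x) \<le> K * norm x"
    using bounded_linear.bounded[OF matrix_vector_mul_bounded_linear[of A]]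
    by (auto simp: mult.commute)
  show ?thesis
  proof (rule gderiv_if_quadratic_remainder)
    fix u
    show "\<bar>dual_fun J A b \<mu> u - dual_fun J A b \<mu> v - (A *v w - b) \<bullet> (u - v)\<bar>
        \<le> (\<mu> / 2 * K\<^sup>2) * (norm (u - v))\<^sup>2"
      using dual_fun_subgradient[OF J \<mu> w, of u] dual_fun_upper[OF J \<mu> w K, of u] by linarith
  qed
qed

lemmas gradient_dual_fun = gradient_eqI[OF gderiv_dual_fun]

lemma \<alpha>_of_nat: "\<alpha> (int k) = 1 + real k / (real k + 3)"
  by (simp add: \<alpha>_def \<theta>_def field_simps)

section \<open>Convergence of the accelerated method\<close>

theorem theorem3p4:
  fixes J :: "real ^ 'n \<Rightarrow> real"
    and A :: "real ^ 'n ^ 'm"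
    and b :: "real ^ 'm"
    and \<mu> L \<tau> :: real
    and xs :: "real ^ 'n" and ys :: "real ^ 'm"
    and x p xt pt w :: "nat \<Rightarrow> real ^ 'n"
    and y yt :: "nat \<Rightarrow> real ^ 'm"
  assumes "continuous_on UNIV J"
    and "convex_on UNIV J"
    and "\<mu> > 0"
    and "optimal_pair J A b \<mu> xs ys"
    and "L > 0"
    and "L-lipschitz_on UNIV (gradient (dual_fun J A b \<mu>))"
    and "0 < \<tau>" and "\<tau> \<le> 1 / L"
    and "accelerated_linearized_bregman J A b \<mu> \<tau> x p xt pt"
    and "accelerated_dual_sequence J A b \<mu> \<tau> w y yt"
  shows "(\<forall>k::nat\<ge>1. dual_fun J A b \<mu> (y k) - dual_fun J A b \<mu> ys
            \<le> 2 * (norm (ys - y 0))\<^sup>2 / (\<tau> * (real k)\<^sup>2)) \<and>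
         (\<forall>\<beta>::real. 0 < \<beta> \<longrightarrow> \<beta> \<le> 1 \<longrightarrow> \<tau> \<ge> \<beta> / L \<longrightarrow>
           (let C = 2 * L * (norm (ys - y 0))\<^sup>2 / \<beta> in
             \<forall>\<epsilon>::real. \<epsilon> > 0 \<longrightarrow>
               (\<forall>k::nat. int k \<ge> \<lceil>sqrt (C / \<epsilon>)\<rceil> \<longrightarrow>
                 lagrangian J A b \<mu> xs ys - lagrangian J A b \<mu> (x (Suc k)) (y k) \<le> \<epsilon>)))"
proof -
  let ?G = "dual_fun J A b \<mu>"
  note J = assms(1,2) and \<mu> = assms(3)
  have L: "L > 0" and \<tau>: "0 < \<tau>" "L * \<tau> \<le> 1"
    using assms(5,7,8) by (auto simp: field_simps)
  have min: "?G ys \<le> ?G v" for v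
    using assms(4) by (simp add: optimal_pair_def is_arg_min_linorder)
  have dual: "y 0 = \<tau> *\<^sub>R b" "yt 0 = \<tau> *\<^sub>R b"
    "\<And>k. is_arg_min (\<lambda>z. lagrangian J A b \<mu> z (yt k)) (\<lambda>_. True) (w (Suc k))"
    "\<And>k. y (Suc k) = yt k - \<tau> *\<^sub>R (A *v w (Suc k) - b)"
    "\<And>k. yt (Suc k) = \<alpha> (int k) *\<^sub>R y (Suc k) + (1 - \<alpha> (int k)) *\<^sub>R y k"
    using assms(10) by (simp_all add: accelerated_dual_sequence_def)
  have gderiv: "GDERIV ?G v :> gradient ?G v"
    and subgradient: "?G v + gradient ?G v \<bullet> (v' - v) \<le> ?G v'" for v v'
  proof -
    obtain z where z: "is_arg_min (\<lambda>z. lagrangian J A b \<mu> z v) (\<lambda>_. True) z"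
      using lagrangian_has_arg_min[OF J \<mu>] by blast
    show "GDERIV ?G v :> gradient ?G v"
      using gderiv_dual_fun[OF J \<mu> z] gradient_dual_fun[OF J \<mu> z] by simp
    show "?G v + gradient ?G v \<bullet> (v' - v) \<le> ?G v'"
      using dual_fun_subgradient[OF J \<mu> z] gradient_dual_fun[OF J \<mu> z] by simp
  qed
  have rate: "?G (y (Suc k)) - ?G ys \<le> 2 * (norm (ys - y 0))\<^sup>2 / (\<tau> * (real k + 2)\<^sup>2)" for k
  proof (rule nesterov_rate[where g = "gradient ?G" and L = L and yt = yt])
    show "?G v' \<le> ?G v + gradient ?G v \<bullet> (v' - v) + L / 2 * (norm (v' - v))\<^sup>2" for v v'
      using gderiv assms(6) by (rule lipschitz_gradient_descent)
    show "y (Suc k) = yt k - \<tau> *\<^sub>R gradient ?G (yt k)" for k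
      using dual(4) gradient_dual_fun[OF J \<mu> dual(3)] by simp
    show "yt (Suc k) = y (Suc k) + (real k / (real k + 3)) *\<^sub>R (y (Suc k) - y k)" for k
      unfolding dual(5) \<alpha>_of_nat by (simp add: algebra_simps)
  qed (use min subgradient \<tau> dual(1,2) in auto)
  have rate': "?G (y k) - ?G ys \<le> 2 * (norm (ys - y 0))\<^sup>2 / (\<tau> * (real k)\<^sup>2)" if k1: "k \<ge> 1" for k
  proof -
    obtain j where k: "k = Suc j" using k1 by (cases k) auto
    have "2 * (norm (ys - y 0))\<^sup>2 / (\<tau> * (real j + 2)\<^sup>2)
        \<le> 2 * (norm (ys - y 0))\<^sup>2 / (\<tau> * (real k)\<^sup>2)"
      using \<tau>(1) k by (intro divide_left_mono mult_left_mono power_mono) auto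
    then show ?thesis using rate[of j] unfolding k by linarith
  qed
  have gap: "lagrangian J A b \<mu> xs ys - lagrangian J A b \<mu> (x (Suc k)) (y k) \<le> \<epsilon>"
    if \<beta>: "0 < \<beta>" "\<beta> / L \<le> \<tau>" and \<epsilon>: "0 < \<epsilon>"
      and k: "\<lceil>sqrt (2 * L * (norm (ys - y 0))\<^sup>2 / \<beta> / \<epsilon>)\<rceil> \<le> int k" for \<beta> \<epsilon> k
  proof -
    let ?C = "2 * L * (norm (ys - y 0))\<^sup>2 / \<beta>"
    have "sqrt (?C / \<epsilon>) \<le> real k" using k by (simp add: ceiling_le_iff)
    then have "?C / \<epsilon> \<le> (real k)\<^sup>2" by (rule sqrt_le_D)
    then have C: "?C \<le> \<epsilon> * (real k)\<^sup>2"
      using \<epsilon> by (simp only: pos_divide_le_eq mult.commute)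
    have "?G (y k) - ?G ys \<le> \<epsilon>"
    proof (cases "k = 0")
      case True
      then have "(norm (ys - y 0))\<^sup>2 \<le> 0"
        using C L \<beta>(1) by (simp add: divide_le_eq mult_le_0_iff)
      then show ?thesis using True \<epsilon> by simp
    next
      case False
      have "1 / \<tau> \<le> L / \<beta>" using \<beta> L \<tau>(1) by (simp add: field_simps)
      then have "1 / \<tau> * (2 * (norm (ys - y 0))\<^sup>2) \<le> L / \<beta> * (2 * (norm (ys - y 0))\<^sup>2)"
        by (rule mult_right_mono) simp
      also have "\<dots> \<le> \<epsilon> * (real k)\<^sup>2" using C by (simp add: mult_ac)
      finally have "2 * (norm (ys - y 0))\<^sup>2 / (\<tau> * (real k)\<^sup>2) \<le> \<epsilon>"
        using False \<tau>(1) by (simp add: field_simps)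
      then show ?thesis using rate'[of k] False by simp
    qed
    moreover have "lagrangian J A b \<mu> xs ys = - ?G ys"
      using assms(4) by (simp add: optimal_pair_def)
    ultimately show ?thesis
      using weak_duality[OF J \<mu>, of A b "y k" "x (Suc k)"] by linarith
  qed
  show ?thesis
    unfolding Let_def using rate' gap by blast
qed

end
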